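(* Let $n\ge 1$ be an integer, let $1\le p_2<p_1<\infty$, and let $\Psi_1,\Psi_2:(0,\infty)\to(0,\infty)$ be measurable functions. Assume that there is a constant $A_1>0$ such that $\frac{1}{A_1}\le\frac{\Psi_1(s)}{\Psi_1(r)}\le A_1$ for all $r,s>0$ with $1\le\frac{s}{r}\le2$, and that there is a constant $A_3>0$ such that $\frac{\Psi_2(s)}{\Psi_2(r)}\le A_3$ for all $r,s>0$ with $1\le\frac{s}{r}\le 2$. If $$\int_0^1\frac{\Psi_1(t)^{p_2}\,\Psi_2(t)}{t}\,dt<\infty,$$ then $wL^{p_1,\Psi_1}\subseteq S_{p_2,\Psi_2}$.
   Context: Let $B(x,r):=\{y\in\mathbb{R}^n:|x-y|<r\}$ and let $|E|$ denote Lebesgue measure. For $1\le p<\infty$ and a measurable function $\Psi:(0,\infty)\to(0,\infty)$: The generalized weak Morrey space $wL^{p,\Psi}=wL^{p,\Psi}(\mathbb{R}^n)$ is the set of all measurable functions $f$ on $\mathbb{R}^n$ with $$\|f\|_{wL^{p,\Psi}}:=\sup_{a\in\mathbb{R}^n,\,r>0,\,t>0}\frac{t\,|\{x\in B(a,r):|f(x)|>t\}|^{1/p}}{\Psi(r)\,|B(a,r)|^{1/p}}<\infty.$$ The Stummel $p$-modulus of $f\in L^p_{\rm loc}(\mathbb{R}^n)$ is $$\eta_{p,\Psi}f(r):=\sup_{x\in\mathbb{R}^n}\left(\int_{|x-y|<r}\frac{|f(y)|^p\,\Psi(|x-y|)}{|x-y|^n}\,dy\right)^{1/p}\in[0,\infty],\quad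 r>0,$$ which is nondecreasing in $r$, and the generalized Stummel $p$-class is $S_{p,\Psi}=S_{p,\Psi}(\mathbb{R}^n):=\{f\in L^p_{\rm loc}(\mathbb{R}^n):\ \eta_{p,\Psi}f(r)\searrow 0 \text{ as } r\searrow 0\}$, i.e. $\lim_{r\to0^+}\eta_{p,\Psi}f(r)=0$. *)

theory Defs
  imports "HOL-Analysis.Analysis"
begin

(* Conventions.  R^n is real ^ 'n with n = CARD('n).  The scalars are an arbitrary real normed
   field, so that real-valued and complex-valued functions are both covered.  "Measurable" means
   Lebesgue measurable.  The weight Psi : (0,\<infinity>) \<rightarrow> (0,\<infinity>) is a function real => real of which only the
   values on the positive half-line matter. *)

(* Real powers of elements of [0,\<infinity>], for exponents a > 0. *)
definition ennreal_powr :: "ennreal \<Rightarrow> real \<Rightarrow> ennreal" where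
  "ennreal_powr x a = (if x = \<infinity> then \<infinity> else ennreal (enn2real x powr a))"

definition weight :: "(real \<Rightarrow> real) \<Rightarrow> bool" where
  "weight \<Psi> \<longleftrightarrow> \<Psi> \<in> borel_measurable (lebesgue_on {0<..}) \<and> (\<forall>r>0. \<Psi> r > 0)"

definition weak_morrey_norm ::
    "real \<Rightarrow> (real \<Rightarrow> real) \<Rightarrow> (real ^ 'n \<Rightarrow> 'k::real_normed_field) \<Rightarrow> ennreal" where
  "weak_morrey_norm p \<Psi> f =
     (SUP (a, r, t) \<in> UNIV \<times> {0<..} \<times> {0<..}.
        ennreal (t * measure lebesgue {x \<in> ball a r. norm (f x) > t} powr (1 / p)
                 / (\<Psi> r * measure lebesgue (ball a r) powr (1 / p))))"

definition weak_morrey ::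
    "real \<Rightarrow> (real \<Rightarrow> real) \<Rightarrow> (real ^ 'n \<Rightarrow> 'k::real_normed_field) set" where
  "weak_morrey p \<Psi> = {f \<in> borel_measurable lebesgue. weak_morrey_norm p \<Psi> f < \<infinity>}"

definition Lp_loc :: "real \<Rightarrow> (real ^ 'n \<Rightarrow> 'k::real_normed_field) set" where
  "Lp_loc p = {f \<in> borel_measurable lebesgue.
     \<forall>K. compact K \<longrightarrow> (\<lambda>x. norm (f x) powr p) absolutely_integrable_on K}"

(* At the single point y = x the integrand is 0, since division by 0 yields 0. *)
definition stummel_modulus ::
    "real \<Rightarrow> (real \<Rightarrow> real) \<Rightarrow> (real ^ 'n \<Rightarrow> 'k::real_normed_field) \<Rightarrow> real \<Rightarrow> ennreal" where
  "stummel_modulus p \<Psi> f r =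
     (SUP x. ennreal_powr
        (\<integral>\<^sup>+ y \<in> ball x r.
           ennreal (norm (f y) powr p * \<Psi> (norm (x - y)) / norm (x - y) ^ CARD('n)) \<partial>lebesgue)
        (1 / p))"

definition stummel_class ::
    "real \<Rightarrow> (real \<Rightarrow> real) \<Rightarrow> (real ^ 'n \<Rightarrow> 'k::real_normed_field) set" where
  "stummel_class p \<Psi> = {f \<in> Lp_loc p. (stummel_modulus p \<Psi> f \<longlongrightarrow> 0) (at_right 0)}"

end

theory Submission
  imports Defs
begin

text \<open>
  Summing the weak-type bound over the dyadic levels \<open>2\<^sup>k N \<Psi>\<^sub>1(r)\<close>, which converges because
  \<open>p\<^sub>2 < p\<^sub>1\<close>, bounds the integral of \<open>|f|\<close> to the power \<open>p\<^sub>2\<close> over a ball of radius \<open>r\<close> by a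
  multiple of \<open>\<Psi>\<^sub>1(r)\<close> to the power \<open>p\<^sub>2\<close> times \<open>r\<^sup>n\<close>.  Cutting a ball of radius \<open>2\<^sup>-\<^sup>m\<close> into dyadic
  annuli and using the doubling of \<open>\<Psi>\<^sub>2\<close>, the Stummel integral is at most a constant times the
  sum over \<open>k \<ge> m\<close> of \<open>\<Psi>\<^sub>1(2\<^sup>-\<^sup>k)\<close> to the power \<open>p\<^sub>2\<close> times \<open>\<Psi>\<^sub>2(2\<^sup>-\<^sup>k\<^sup>-\<^sup>1)\<close>, uniformly in the centre.
  By doubling, each of these terms is controlled by the integral of the hypothesis over
  \<open>[2\<^sup>-\<^sup>k\<^sup>-\<^sup>2, 2\<^sup>-\<^sup>k\<^sup>-\<^sup>1)\<close>, so the series converges and its tails tend to 0.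
\<close>

section \<open>Dyadic levels and integration of weak-type bounds\<close>

lemma obtain_dyadic_scale:
  fixes u L :: real
  assumes "0 < L" "L < u"
  obtains k :: nat where "2 ^ k * L < u" "u \<le> 2 ^ Suc k * L"
proof -
  define P where "P = (\<lambda>n::nat. u \<le> 2 ^ n * L)"
  obtain n where "u / L < 2 ^ n"
    using real_arch_pow[of 2 "u / L"] by auto
  then have "P n"
    using assms by (simp add: P_def field_simps)
  moreover have "\<not> P 0"
    using assms by (simp add: P_def)
  ultimately obtain k where "\<not> P k" "P (Suc k)"
    using ex_least_nat_less[of P n] by blast
  then show ?thesis
    using that by (auto simp: P_def not_le)
qed

lemma ennreal_le_suminf:
  fixes f :: "nat \<Rightarrow> ennreal"
  shows "f k \<le> suminf f"
  using sum_le_suminf[of f "{k}"] by simp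

text \<open>For \<open>u > L\<close> the one index k whose dyadic interval contains u already
  suffices. The terms carry superlevel sets rather than dyadic slices, because a weak-type
  hypothesis controls exactly those.\<close>

lemma powr_le_dyadic_suminf:
  fixes u L p :: real
  assumes "0 \<le> u" "0 < L" "0 \<le> p"
  shows "ennreal (u powr p) \<le> ennreal (L powr p) +
    (\<Sum>k. ennreal ((2 ^ Suc k * L) powr p) * indicator {v. 2 ^ k * L < v} u)"
proof (cases "u \<le> L")
  case True
  then have "ennreal (u powr p) \<le> ennreal (L powr p)"
    using assms by (intro ennreal_leI powr_mono2) auto
  then show ?thesis
    by (simp add: add_increasing2)
next
  case False
  then obtain k :: nat where k: "2 ^ k * L < u" "u \<le> 2 ^ Suc k * L"
    using obtain_dyadic_scale[of L u] assms by auto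
  let ?f = "\<lambda>k. ennreal ((2 ^ Suc k * L) powr p) * indicator {v. 2 ^ k * L < v} u"
  have "ennreal (u powr p) \<le> ?f k"
    using k assms by (auto intro!: ennreal_leI powr_mono2)
  also have "?f k \<le> (\<Sum>k. ?f k)"
    by (rule ennreal_le_suminf)
  finally show ?thesis
    by (simp add: add_increasing)
qed

text \<open>At level k the weight \<open>(2 ^ Suc k * L) powr p\<close> meets a set of measure at
  most \<open>V / (2 powr q) ^ k\<close>, so the contributions are dominated by a geometric series
  of ratio \<open>2 powr (p - q)\<close>, which is below 1 because \<open>p < q\<close>. The summand
  1 in the constant pays for the points with \<open>g x \<le> L\<close>, where the weak bound says
  little and the size of \<open>S\<close> is used instead.\<close>

lemma nn_integral_powr_le_weak_type:
  fixes g :: "'a \<Rightarrow> real" and p q L V :: real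
  assumes g: "g \<in> borel_measurable M" "\<And>x. 0 \<le> g x" and S: "S \<in> sets M"
    and pq: "0 < p" "p < q" and L: "0 < L" and V: "0 \<le> V" "emeasure M S \<le> ennreal V"
    and weak: "\<And>t. 0 < t \<Longrightarrow> emeasure M {x \<in> S. t < g x} \<le> ennreal ((L / t) powr q * V)"
  shows "(\<integral>\<^sup>+ x \<in> S. ennreal (g x powr p) \<partial>M)
    \<le> ennreal ((1 + 2 powr p / (1 - 2 powr (p - q))) * (L powr p * V))"
proof -
  have [measurable]: "g \<in> borel_measurable M" "S \<in> sets M"
    using g S by auto
  define A where "A k = {x \<in> S. 2 ^ k * L < g x}" for k :: nat
  have A_eq: "A k = S \<inter> {x \<in> space M. 2 ^ k * L < g x}" for k
    using sets.sets_into_space[OF S] by (auto simp: A_def)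
  have [measurable]: "A k \<in> sets M" for k
    unfolding A_eq by measurable
  define c where "c k = (2 ^ Suc k * L) powr p" for k :: nat
  have c_A: "ennreal (c k) * emeasure M (A k)
      \<le> ennreal (2 powr p * (L powr p * V) * (2 powr (p - q)) ^ k)" for k
  proof -
    have "ennreal (c k) * emeasure M (A k)
        \<le> ennreal (c k) * ennreal ((L / (2 ^ k * L)) powr q * V)"
      unfolding A_def using L by (intro mult_left_mono weak) auto
    also have "\<dots> = ennreal (c k * ((L / (2 ^ k * L)) powr q * V))"
      using V by (simp add: c_def ennreal_mult)
    also have "c k * ((L / (2 ^ k * L)) powr q * V)
        = 2 powr p * (L powr p * V) * (2 powr (p - q)) ^ k"
    proof -
      have "c k = 2 powr p * (2 powr p) ^ k * L powr p"
        using L by (simp add: c_def powr_mult powr_power powr_powr mult.commute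
            flip: powr_realpow)
      moreover have "(L / (2 ^ k * L)) powr q = 1 / (2 powr q) ^ k"
        using L by (simp add: powr_divide powr_power powr_powr mult.commute
            flip: powr_realpow)
      ultimately show ?thesis
        by (simp add: powr_diff power_divide)
    qed
    finally show ?thesis .
  qed
  have geom: "(\<lambda>k. 2 powr p * (L powr p * V) * (2 powr (p - q)) ^ k)
      sums (2 powr p * (L powr p * V) * (1 / (1 - 2 powr (p - q))))"
    using pq by (intro sums_mult geometric_sums) (simp add: powr_less_one)
  have q1: "2 powr (p - q) < 1"
    using pq by (simp add: powr_less_one)
  have "(\<integral>\<^sup>+ x \<in> S. ennreal (g x powr p) \<partial>M)
      \<le> (\<integral>\<^sup>+ x. ennreal (L powr p) * indicator S x
            + (\<Sum>k. ennreal (c k) * indicator (A k) x) \<partial>M)"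
  proof (rule nn_integral_mono)
    fix x
    show "ennreal (g x powr p) * indicator S x
        \<le> ennreal (L powr p) * indicator S x + (\<Sum>k. ennreal (c k) * indicator (A k) x)"
    proof (cases "x \<in> S")
      case True
      then have "indicator (A k) x = (indicator {v. 2 ^ k * L < v} (g x) :: ennreal)" for k
        by (auto simp: A_def indicator_def)
      then show ?thesis
        using True powr_le_dyadic_suminf[of "g x" L p] g(2) L pq by (simp add: c_def)
    qed simp
  qed
  also have "\<dots> = ennreal (L powr p) * emeasure M S + (\<Sum>k. ennreal (c k) * emeasure M (A k))"
    by (simp add: nn_integral_add nn_integral_suminf nn_integral_cmult_indicator)
  also have "\<dots> \<le> ennreal (L powr p) * ennreal V
      + (\<Sum>k. ennreal (2 powr p * (L powr p * V) * (2 powr (p - q)) ^ k))"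
    by (intro add_mono mult_left_mono suminf_le V c_A) auto
  also have "(\<Sum>k. ennreal (2 powr p * (L powr p * V) * (2 powr (p - q)) ^ k))
      = ennreal (2 powr p * (L powr p * V) * (1 / (1 - 2 powr (p - q))))"
    using V by (intro suminf_ennreal_eq geom) auto
  also have "ennreal (L powr p) * ennreal V + \<dots>
      = ennreal (L powr p * V + 2 powr p * (L powr p * V) * (1 / (1 - 2 powr (p - q))))"
    using V q1 by (subst ennreal_plus) (auto simp: ennreal_mult)
  also have "L powr p * V + 2 powr p * (L powr p * V) * (1 / (1 - 2 powr (p - q)))
      = (1 + 2 powr p / (1 - 2 powr (p - q))) * (L powr p * V)"
    by (simp add: algebra_simps)
  finally show ?thesis .
qed

section \<open>Weak Morrey functions on balls\<close>

lemma weak_morrey_level_set: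
  fixes f :: "real ^ 'n \<Rightarrow> 'k::real_normed_field"
  assumes f: "f \<in> weak_morrey q \<Psi>" and q: "0 < q" and \<Psi>: "\<And>r. 0 < r \<Longrightarrow> 0 < \<Psi> r"
  shows "\<exists>N>0. \<forall>a. \<forall>r>0. \<forall>t>0. emeasure lebesgue {x \<in> ball a r. t < norm (f x)}
       \<le> ennreal ((N * \<Psi> r / t) powr q * measure lebesgue (ball a r))"
proof -
  have meas: "f \<in> borel_measurable lebesgue" and fin: "weak_morrey_norm q \<Psi> f < \<infinity>"
    using f by (auto simp: weak_morrey_def)
  \<comment> \<open>Adding 1 keeps \<open>N\<close> positive even when the norm is 0.\<close>
  define N where "N = enn2real (weak_morrey_norm q \<Psi> f) + 1"
  have N: "0 < N" "weak_morrey_norm q \<Psi> f \<le> ennreal N"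
    using fin by (auto simp: N_def ennreal_enn2real_if add_nonneg_pos intro: order.trans[OF _ ennreal_leI])
  have "emeasure lebesgue {x \<in> ball a r. t < norm (f x)}
      \<le> ennreal ((N * \<Psi> r / t) powr q * measure lebesgue (ball a r))" if "0 < r" "0 < t" for a r t
  proof -
    let ?E = "{x \<in> ball a r. t < norm (f x)}"
    define \<mu> where "\<mu> = measure lebesgue ?E"
    define b where "b = measure lebesgue (ball a r)"
    have b: "0 < b"
      using content_ball_pos[OF \<open>0 < r\<close>, of a] by (simp add: b_def)
    have "(\<lambda>x. norm (f x)) \<in> borel_measurable lebesgue"
      using meas by measurable
    then have "{x \<in> space lebesgue. t < norm (f x)} \<inter> ball a r \<in> sets lebesgue"
      using fmeasurableD[OF lmeasurable_ball[of a r]] by measurable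
    also have "{x \<in> space lebesgue. t < norm (f x)} \<inter> ball a r = ?E"
      by auto
    finally have "?E \<in> sets lebesgue" .
    \<comment> \<open>The norm is defined through \<open>measure\<close>, which is 0 on
      nonmeasurable sets and on sets of infinite measure. Only for a measurable set of finite
      measure does the bound carry over to \<open>emeasure\<close>.\<close>
    then have "?E \<in> lmeasurable"
      by (intro fmeasurableI2[OF lmeasurable_ball[of a r]]) auto
    then have E: "emeasure lebesgue ?E = ennreal \<mu>"
      by (simp add: \<mu>_def emeasure_eq_measure2)
    have "ennreal (t * \<mu> powr (1 / q) / (\<Psi> r * b powr (1 / q))) \<le> weak_morrey_norm q \<Psi> f"
      unfolding weak_morrey_norm_def \<mu>_def b_def using that
      by (intro SUP_upper2[of "(a, r, t)"]) auto
    also note N(2)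
    finally have "t * \<mu> powr (1 / q) / (\<Psi> r * b powr (1 / q)) \<le> N"
      using N by simp
    then have "\<mu> powr (1 / q) \<le> N * \<Psi> r / t * b powr (1 / q)"
      using b that \<Psi>[of r] by (simp add: field_simps)
    then have "(\<mu> powr (1 / q)) powr q \<le> (N * \<Psi> r / t * b powr (1 / q)) powr q"
      using q by (intro powr_mono2) auto
    moreover have "(\<mu> powr (1 / q)) powr q = \<mu>"
      using q by (simp add: powr_powr \<mu>_def)
    moreover have "(N * \<Psi> r / t * b powr (1 / q)) powr q = (N * \<Psi> r / t) powr q * b"
      using q b N that \<Psi>[of r] by (subst powr_mult) (auto simp: powr_powr)
    ultimately have "\<mu> \<le> (N * \<Psi> r / t) powr q * b"
      by simp
    then show ?thesis
      unfolding E b_def by (rule ennreal_leI)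
  qed
  with N(1) show ?thesis
    by blast
qed

text \<open>With \<open>N * \<Psi> r\<close> as base level and the volume of the ball as
  \<open>V\<close>, the level set estimate is exactly the hypothesis of
  \<open>nn_integral_powr_le_weak_type\<close>. The volume scales like the n-th power of the radius,
  so one constant serves all centres and radii.\<close>

lemma weak_morrey_local_integral:
  fixes f :: "real ^ 'n \<Rightarrow> 'k::real_normed_field"
  assumes f: "f \<in> weak_morrey q \<Psi>" and pq: "0 < p" "p < q" and \<Psi>: "\<And>r. 0 < r \<Longrightarrow> 0 < \<Psi> r"
  shows "\<exists>C>0. \<forall>a. \<forall>r>0. (\<integral>\<^sup>+ y \<in> ball a r. ennreal (norm (f y) powr p) \<partial>lebesgue)
       \<le> ennreal (C * (\<Psi> r powr p * r ^ CARD('n)))"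
proof -
  have meas: "f \<in> borel_measurable lebesgue"
    using f by (auto simp: weak_morrey_def)
  obtain N where N: "0 < N"
    "\<And>a r t. 0 < r \<Longrightarrow> 0 < t \<Longrightarrow> emeasure lebesgue {x \<in> ball a r. t < norm (f x)}
       \<le> ennreal ((N * \<Psi> r / t) powr q * measure lebesgue (ball a r))"
    using weak_morrey_level_set[OF f order_less_trans[OF pq] \<Psi>] by blast
  define K where "K = 1 + 2 powr p / (1 - 2 powr (p - q))"
  have q1: "2 powr (p - q) < 1"
    using pq by (simp add: powr_less_one)
  then have K: "0 < K"
    by (auto simp: K_def intro!: add_pos_nonneg)
  define C where "C = K * (N powr p * unit_ball_vol (real CARD('n)))"
  have "(\<integral>\<^sup>+ y \<in> ball a r. ennreal (norm (f y) powr p) \<partial>lebesgue)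
       \<le> ennreal (C * (\<Psi> r powr p * r ^ CARD('n)))" if "0 < r" for a r
  proof -
    have "(\<integral>\<^sup>+ y \<in> ball a r. ennreal (norm (f y) powr p) \<partial>lebesgue)
      \<le> ennreal (K * ((N * \<Psi> r) powr p * measure lebesgue (ball a r)))"
      unfolding K_def
    proof (rule nn_integral_powr_le_weak_type[OF _ _ _ pq])
      show "(\<lambda>x. norm (f x)) \<in> borel_measurable lebesgue"
        using meas by measurable
      show "emeasure lebesgue (ball a r) \<le> ennreal (measure lebesgue (ball a r))"
        using lmeasurable_ball[of a r] emeasure_eq_measure2 by fastforce
    qed (use N \<Psi>[OF that] that in auto)
    also have "K * ((N * \<Psi> r) powr p * measure lebesgue (ball a r))
        = C * (\<Psi> r powr p * r ^ CARD('n))"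
      using N \<Psi>[OF that] that by (simp add: C_def powr_mult content_ball)
    finally show ?thesis .
  qed
  moreover have "0 < C"
    using K N by (simp add: C_def)
  ultimately show ?thesis
    by blast
qed

text \<open>A compact set fits into a ball centred at 0, on which the integral bound is finite. This
  supplies the local integrability built into the Stummel class.\<close>

lemma weak_morrey_subset_Lp_loc:
  assumes pq: "0 < p" "p < q" and \<Psi>: "\<And>r. 0 < r \<Longrightarrow> 0 < \<Psi> r"
  shows "(weak_morrey q \<Psi> :: (real ^ 'n \<Rightarrow> 'k::real_normed_field) set) \<subseteq> Lp_loc p"
proof
  fix f :: "real ^ 'n \<Rightarrow> 'k"
  assume f: "f \<in> weak_morrey q \<Psi>"
  then have meas: "f \<in> borel_measurable lebesgue"
    by (auto simp: weak_morrey_def)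
  have [measurable]: "(\<lambda>x. norm (f x)) \<in> borel_measurable lebesgue"
    using meas by measurable
  obtain C where C: "\<And>a r. 0 < r \<Longrightarrow>
      (\<integral>\<^sup>+ y \<in> ball a r. ennreal (norm (f y) powr p) \<partial>lebesgue)
       \<le> ennreal (C * (\<Psi> r powr p * r ^ CARD('n)))"
    using weak_morrey_local_integral[OF f pq \<Psi>] by blast
  have "(\<lambda>x. norm (f x) powr p) absolutely_integrable_on K" if K: "compact K" for K
  proof -
    obtain r where r: "0 < r" "K \<subseteq> ball 0 r"
      using bounded_subset_ballD[OF compact_imp_bounded[OF K]] by blast
    have [measurable]: "K \<in> sets lebesgue"
      using lmeasurable_compact[OF K] by auto
    have "(\<integral>\<^sup>+ y. ennreal (norm (indicator K y *\<^sub>R norm (f y) powr p)) \<partial>lebesgue)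
        \<le> (\<integral>\<^sup>+ y \<in> ball 0 r. ennreal (norm (f y) powr p) \<partial>lebesgue)"
      using r by (intro nn_integral_mono) (auto simp: indicator_def)
    also have "\<dots> < \<infinity>"
      using C[OF r(1), of 0] by (simp add: le_less_trans)
    finally show ?thesis
      unfolding set_integrable_def by (intro integrableI_bounded) auto
  qed
  with meas show "f \<in> Lp_loc p"
    by (auto simp: Lp_loc_def)
qed

section \<open>Stummel integrals and the dyadic series\<close>

lemma ennreal_powr_le:
  assumes "x \<le> ennreal c" "0 \<le> a"
  shows "ennreal_powr x a \<le> ennreal (c powr a)"
proof (cases "0 \<le> c")
  case True
  then have "x \<noteq> \<infinity>" "enn2real x \<le> c"
    using assms by (auto simp: top_unique enn2real_leI)
  then show ?thesis
    using assms by (auto simp: ennreal_powr_def intro!: ennreal_leI powr_mono2)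
next
  \<comment> \<open>A negative \<open>c\<close> is truncated to 0 by \<open>ennreal\<close>, which
    forces \<open>x = 0\<close>.\<close>
  case False
  then have "x = 0"
    using assms by (simp add: ennreal_neg)
  then show ?thesis
    by (simp add: ennreal_powr_def)
qed

text \<open>On the annulus between \<open>R / 2 ^ Suc k\<close> and \<open>R / 2 ^ k\<close> the
  kernel is compared with its value at the inner radius: the negative power of the distance is
  largest there, and the doubling hypothesis bounds values at larger radii by values at smaller
  ones. Each annulus is then enlarged to the full ball of its outer radius, since the integrals of f
  are controlled over balls.\<close>

lemma stummel_integral_le_suminf:
  fixes f :: "real ^ 'n \<Rightarrow> 'k::real_normed_field"
  assumes [measurable]: "f \<in> borel_measurable lebesgue"
    and \<Psi>: "\<And>r. 0 < r \<Longrightarrow> 0 < \<Psi> r" and A: "0 < A"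
    and doubling: "\<And>r s. \<lbrakk>0 < r; r \<le> s; s \<le> 2 * r\<rbrakk> \<Longrightarrow> \<Psi> s \<le> A * \<Psi> r"
    and R: "0 < R"
  shows "(\<integral>\<^sup>+ y \<in> ball x R.
      ennreal (norm (f y) powr p * \<Psi> (norm (x - y)) / norm (x - y) ^ CARD('n)) \<partial>lebesgue)
    \<le> (\<Sum>k. ennreal (A * \<Psi> (R / 2 ^ Suc k) / (R / 2 ^ Suc k) ^ CARD('n)) *
        (\<integral>\<^sup>+ y \<in> ball x (R / 2 ^ k). ennreal (norm (f y) powr p) \<partial>lebesgue))"
proof -
  have [measurable]: "(\<lambda>x. norm (f x)) \<in> borel_measurable lebesgue"
    by measurable
  have [measurable]: "ball x r \<in> sets lebesgue" for r
    by (rule fmeasurableD[OF lmeasurable_ball])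
  define c where "c k = A * \<Psi> (R / 2 ^ Suc k) / (R / 2 ^ Suc k) ^ CARD('n)" for k
  let ?h = "\<lambda>k y. ennreal (c k) * (ennreal (norm (f y) powr p) * indicator (ball x (R / 2 ^ k)) y)"
  have c: "0 \<le> c k" for k
    using A R \<Psi>[of "R / 2 ^ Suc k"] by (simp add: c_def less_imp_le)
  have "ennreal (norm (f y) powr p * \<Psi> (norm (x - y)) / norm (x - y) ^ CARD('n))
      * indicator (ball x R) y \<le> (\<Sum>k. ?h k y)" for y
  proof (cases "y \<in> ball x R \<and> y \<noteq> x")
    \<comment> \<open>At \<open>y = x\<close> the integrand is 0 by the convention for division by
      0; elsewhere the indicator of the ball vanishes.\<close>
    case False
    then show ?thesis
      by (cases "y = x") (auto simp: zero_power)
  next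
    case True
    define d where "d = norm (x - y)"
    have d: "0 < d" "d < R"
      using True by (auto simp: d_def dist_norm)
    \<comment> \<open>Radii shrink while dyadic scales grow, hence the reciprocals. The strict
      inequality turns into \<open>d < R / 2 ^ k\<close>, which puts y in the open ball.\<close>
    obtain k :: nat where k: "2 ^ k * (1 / R) < 1 / d" "1 / d \<le> 2 ^ Suc k * (1 / R)"
      using obtain_dyadic_scale[of "1 / R" "1 / d"] d R by (auto simp: field_simps)
    have kd: "R / 2 ^ Suc k \<le> d" "d < R / 2 ^ k"
      using k d R by (simp_all add: field_simps)
    have "\<Psi> d \<le> A * \<Psi> (R / 2 ^ Suc k)"
      using kd R by (intro doubling) (auto simp: field_simps)
    then have "\<Psi> d / d ^ CARD('n) \<le> c k"
      unfolding c_def using kd R \<Psi>[OF d(1)] by (intro frac_le power_mono) auto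
    then have "norm (f y) powr p * \<Psi> d / d ^ CARD('n) \<le> c k * norm (f y) powr p"
      using mult_left_mono[of "\<Psi> d / d ^ CARD('n)" "c k" "norm (f y) powr p"] by (simp add: mult.commute)
    then have "ennreal (norm (f y) powr p * \<Psi> d / d ^ CARD('n)) * indicator (ball x R) y \<le> ?h k y"
      using True kd c by (simp add: d_def dist_norm indicator_def flip: ennreal_mult)
    also have "?h k y \<le> (\<Sum>k. ?h k y)"
      by (rule ennreal_le_suminf)
    finally show ?thesis
      by (simp add: d_def)
  qed
  then have "(\<integral>\<^sup>+ y \<in> ball x R.
      ennreal (norm (f y) powr p * \<Psi> (norm (x - y)) / norm (x - y) ^ CARD('n)) \<partial>lebesgue)
    \<le> (\<integral>\<^sup>+ y. (\<Sum>k. ?h k y) \<partial>lebesgue)"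
    by (rule nn_integral_mono)
  also have "\<dots> = (\<Sum>k. ennreal (c k) *
      (\<integral>\<^sup>+ y \<in> ball x (R / 2 ^ k). ennreal (norm (f y) powr p) \<partial>lebesgue))"
    by (simp add: nn_integral_suminf nn_integral_cmult)
  finally show ?thesis
    unfolding c_def .
qed

text \<open>The integrand is bounded below by a step function. Since doubling bounds a value only by
  values at smaller arguments, the k-th term is compared with points t just below
  \<open>1 / 2 ^ Suc k\<close>, the smaller of its two arguments.\<close>

lemma dyadic_summable:
  fixes A\<^sub>1 A\<^sub>2 p :: real
  assumes p: "0 < p"
    and \<Psi>\<^sub>1: "\<And>r. 0 < r \<Longrightarrow> 0 < \<Psi>\<^sub>1 r" and \<Psi>\<^sub>2: "\<And>r. 0 < r \<Longrightarrow> 0 < \<Psi>\<^sub>2 r"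
    and A: "0 < A\<^sub>1" "0 < A\<^sub>2"
    and d1: "\<And>r s. \<lbrakk>0 < r; r \<le> s; s \<le> 2 * r\<rbrakk> \<Longrightarrow> \<Psi>\<^sub>1 s \<le> A\<^sub>1 * \<Psi>\<^sub>1 r"
    and d2: "\<And>r s. \<lbrakk>0 < r; r \<le> s; s \<le> 2 * r\<rbrakk> \<Longrightarrow> \<Psi>\<^sub>2 s \<le> A\<^sub>2 * \<Psi>\<^sub>2 r"
    and fin: "(\<integral>\<^sup>+ t \<in> {0<..<1}. ennreal (\<Psi>\<^sub>1 t powr p * \<Psi>\<^sub>2 t / t) \<partial>lebesgue) < \<infinity>"
  shows "summable (\<lambda>k. \<Psi>\<^sub>1 (1 / 2 ^ k) powr p * \<Psi>\<^sub>2 (1 / 2 ^ Suc k))"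
proof -
  define \<rho> :: "nat \<Rightarrow> real" where "\<rho> k = 1 / 2 ^ k" for k
  have \<rho>: "0 < \<rho> k" "\<rho> (Suc k) = \<rho> k / 2" for k
    by (auto simp: \<rho>_def)
  have \<rho>_mono: "\<rho> j \<le> \<rho> i" if "i \<le> j" for i j
    using that by (simp add: \<rho>_def frac_le)
  define a where "a k = \<Psi>\<^sub>1 (\<rho> k) powr p * \<Psi>\<^sub>2 (\<rho> (Suc k))" for k
  \<comment> \<open>Passing from \<open>\<rho> k\<close> down to t takes two doublings of the first
    weight; passing from \<open>\<rho> (Suc k)\<close> takes one of the second.\<close>
  define D where "D = (A\<^sub>1 * A\<^sub>1) powr p * A\<^sub>2"
  have D: "0 < D"
    using A by (simp add: D_def)
  have a: "0 \<le> a k" for k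
    using \<Psi>\<^sub>2[OF \<rho>(1), of "Suc k"] by (simp add: a_def)
  define I where "I k = {\<rho> (Suc (Suc k))..<\<rho> (Suc k)}" for k
  have disj: "disjoint_family I"
  proof -
    have "I i \<inter> I j = {}" if "i < j" for i j
      using \<rho>_mono[of "Suc (Suc i)" "Suc j"] that by (auto simp: I_def)
    then show ?thesis
      unfolding disjoint_family_on_def by (metis Int_commute linorder_neqE_nat)
  qed
  have [measurable]: "I k \<in> sets lebesgue" for k
    by (simp add: I_def)
  have emeasure_I: "emeasure lebesgue (I k) = ennreal (\<rho> k / 4)" for k
    by (simp add: I_def \<rho>)
  \<comment> \<open>By disjointness at most one summand is nonzero at t. The height has
    \<open>\<rho> k\<close> in the denominator, which cancels against the length
    \<open>\<rho> k / 4\<close> of \<open>I k\<close>, so each step integrates to a fixed multiple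
    of \<open>a k\<close>.\<close>
  have "(\<Sum>k. ennreal (a k / (D * \<rho> k)) * indicator (I k) t)
      \<le> ennreal (\<Psi>\<^sub>1 t powr p * \<Psi>\<^sub>2 t / t) * indicator {0<..<1} t" for t
  proof (cases "\<exists>k. t \<in> I k")
    case False
    then show ?thesis
      by simp
  next
    case True
    then obtain k where k: "t \<in> I k"
      by auto
    then have t: "\<rho> k / 4 \<le> t" "t < \<rho> k / 2" "0 < t"
      using \<rho>(1)[of k] by (auto simp: I_def \<rho>(2))
    have "\<rho> k \<le> 1"
      by (simp add: \<rho>_def)
    then have "t \<in> {0<..<1}"
      using t by auto
    have "\<Psi>\<^sub>1 (\<rho> k) \<le> A\<^sub>1 * \<Psi>\<^sub>1 (\<rho> k / 2)"
      using \<rho>(1)[of k] by (intro d1) auto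
    also have "\<dots> \<le> A\<^sub>1 * (A\<^sub>1 * \<Psi>\<^sub>1 t)"
      using t A by (intro mult_left_mono d1) auto
    finally have "\<Psi>\<^sub>1 (\<rho> k) powr p \<le> (A\<^sub>1 * A\<^sub>1 * \<Psi>\<^sub>1 t) powr p"
      using p \<Psi>\<^sub>1[OF \<rho>(1), of k] by (intro powr_mono2) (auto simp: mult.assoc)
    moreover have "\<Psi>\<^sub>2 (\<rho> (Suc k)) \<le> A\<^sub>2 * \<Psi>\<^sub>2 t"
      using t by (intro d2) (auto simp: \<rho>(2))
    ultimately have "a k \<le> (A\<^sub>1 * A\<^sub>1 * \<Psi>\<^sub>1 t) powr p * (A\<^sub>2 * \<Psi>\<^sub>2 t)"
      unfolding a_def using \<Psi>\<^sub>2[OF \<rho>(1), of "Suc k"] by (intro mult_mono) auto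
    also have "\<dots> = D * (\<Psi>\<^sub>1 t powr p * \<Psi>\<^sub>2 t)"
      using A \<Psi>\<^sub>1[OF t(3)] by (simp add: D_def powr_mult)
    finally have "a k / (D * \<rho> k) \<le> \<Psi>\<^sub>1 t powr p * \<Psi>\<^sub>2 t / \<rho> k"
      using D \<rho>(1)[of k] by (simp add: field_simps)
    also have "\<dots> \<le> \<Psi>\<^sub>1 t powr p * \<Psi>\<^sub>2 t / t"
      using t \<Psi>\<^sub>2[OF t(3)] \<rho>(1)[of k] by (intro divide_left_mono) auto
    finally show ?thesis
      using suminf_cmult_indicator[OF disj k, of "\<lambda>k. ennreal (a k / (D * \<rho> k))"] \<open>t \<in> {0<..<1}\<close>
      by (simp add: ennreal_leI)
  qed
  then have "(\<integral>\<^sup>+ t. (\<Sum>k. ennreal (a k / (D * \<rho> k)) * indicator (I k) t) \<partial>lebesgue)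
      \<le> (\<integral>\<^sup>+ t \<in> {0<..<1}. ennreal (\<Psi>\<^sub>1 t powr p * \<Psi>\<^sub>2 t / t) \<partial>lebesgue)"
    by (rule nn_integral_mono)
  also note fin
  also have "(\<integral>\<^sup>+ t. (\<Sum>k. ennreal (a k / (D * \<rho> k)) * indicator (I k) t) \<partial>lebesgue)
      = (\<Sum>k. ennreal (a k / (D * \<rho> k)) * emeasure lebesgue (I k))"
    by (simp add: nn_integral_suminf nn_integral_cmult_indicator)
  also have "\<dots> = (\<Sum>k. ennreal (a k / (4 * D)))"
  proof (rule suminf_cong)
    fix k
    have "a k / (D * \<rho> k) * (\<rho> k / 4) = a k / (4 * D)"
      using \<rho>(1)[of k] by simp
    then show "ennreal (a k / (D * \<rho> k)) * emeasure lebesgue (I k) = ennreal (a k / (4 * D))"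
      using D a[of k] \<rho>(1)[of k] by (simp add: emeasure_I flip: ennreal_mult)
  qed
  finally have "summable (\<lambda>k. a k / (4 * D))"
    using a D by (intro summable_suminf_not_top) auto
  then have "summable (\<lambda>k. 4 * D * (a k / (4 * D)))"
    by (rule summable_mult)
  then show ?thesis
    using D by (simp add: a_def \<rho>_def)
qed

text \<open>Carries estimates at the radii \<open>1 / 2 ^ m\<close> over to all smaller
  radii.\<close>

lemma stummel_modulus_mono:
  assumes "r \<le> s" "0 < p"
  shows "stummel_modulus p \<Psi> f r \<le> stummel_modulus p \<Psi> f s"
proof -
  have mono: "ennreal_powr u (1 / p) \<le> ennreal_powr v (1 / p)" if "u \<le> v" for u v
    using ennreal_powr_le[of u "enn2real v" "1 / p"] that \<open>0 < p\<close>
    by (cases v) (auto simp: ennreal_powr_def top_unique)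
  show ?thesis
    unfolding stummel_modulus_def using assms
    by (intro SUP_mono' mono nn_integral_mono) (auto simp: indicator_def)
qed

section \<open>Decay of the modulus and the inclusion\<close>

theorem theorem4p8:
  fixes p\<^sub>1 p\<^sub>2 A\<^sub>1 A\<^sub>3 :: real and \<Psi>\<^sub>1 \<Psi>\<^sub>2 :: "real \<Rightarrow> real"
  assumes "1 \<le> p\<^sub>2" and "p\<^sub>2 < p\<^sub>1"
    and "weight \<Psi>\<^sub>1" and "weight \<Psi>\<^sub>2"
    and "A\<^sub>1 > 0"
    and "\<And>r s. \<lbrakk>r > 0; s > 0; 1 \<le> s / r; s / r \<le> 2\<rbrakk>
           \<Longrightarrow> 1 / A\<^sub>1 \<le> \<Psi>\<^sub>1 s / \<Psi>\<^sub>1 r \<and> \<Psi>\<^sub>1 s / \<Psi>\<^sub>1 r \<le> A\<^sub>1"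
    and "A\<^sub>3 > 0"
    and "\<And>r s. \<lbrakk>r > 0; s > 0; 1 \<le> s / r; s / r \<le> 2\<rbrakk> \<Longrightarrow> \<Psi>\<^sub>2 s / \<Psi>\<^sub>2 r \<le> A\<^sub>3"
    and "(\<integral>\<^sup>+ t \<in> {0<..<1}. ennreal (\<Psi>\<^sub>1 t powr p\<^sub>2 * \<Psi>\<^sub>2 t / t) \<partial>lebesgue) < \<infinity>"
  shows "(weak_morrey p\<^sub>1 \<Psi>\<^sub>1 :: (real ^ 'n \<Rightarrow> 'k::real_normed_field) set) \<subseteq> stummel_class p\<^sub>2 \<Psi>\<^sub>2"
proof
  fix f :: "real ^ 'n \<Rightarrow> 'k"
  assume f: "f \<in> weak_morrey p\<^sub>1 \<Psi>\<^sub>1"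
  have \<Psi>: "0 < \<Psi>\<^sub>1 r" "0 < \<Psi>\<^sub>2 r" if "0 < r" for r
    using assms(3,4) that by (auto simp: weight_def)
  have p: "0 < p\<^sub>2"
    using assms(1) by simp
  have d1: "\<Psi>\<^sub>1 s \<le> A\<^sub>1 * \<Psi>\<^sub>1 r" if "0 < r" "r \<le> s" "s \<le> 2 * r" for r s
    using assms(6)[of r s] that \<Psi>(1)[of r] by (simp add: field_simps)
  have d2: "\<Psi>\<^sub>2 s \<le> A\<^sub>3 * \<Psi>\<^sub>2 r" if "0 < r" "r \<le> s" "s \<le> 2 * r" for r s
    using assms(8)[of r s] that \<Psi>(2)[of r] by (simp add: field_simps)
  obtain C where C: "0 < C" "\<And>a r. 0 < r \<Longrightarrow>
      (\<integral>\<^sup>+ y \<in> ball a r. ennreal (norm (f y) powr p\<^sub>2) \<partial>lebesgue)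
       \<le> ennreal (C * (\<Psi>\<^sub>1 r powr p\<^sub>2 * r ^ CARD('n)))"
    using weak_morrey_local_integral[OF f p assms(2) \<Psi>(1)] by blast
  \<comment> \<open>The first weight sits at the outer radius of an annulus, coming from the
    integral over the ball; the second sits at the inner radius, coming from the kernel.\<close>
  define a where "a k = \<Psi>\<^sub>1 (1 / 2 ^ k) powr p\<^sub>2 * \<Psi>\<^sub>2 (1 / 2 ^ Suc k)" for k :: nat
  have a: "0 \<le> a k" for k
    using \<Psi>(2)[of "1 / 2 ^ Suc k"] by (simp add: a_def)
  have "summable a"
    unfolding a_def by (rule dyadic_summable[OF p \<Psi> assms(5,7) d1 d2 assms(9)])
  \<comment> \<open>\<open>A\<^sub>3\<close> comes from doubling in the kernel, \<open>C\<close>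
    from the local integrals, and the power of 2 from the ratio of outer to inner radius.\<close>
  define B where "B = A\<^sub>3 * C * 2 ^ CARD('n)"
  define T where "T m = B * (\<Sum>k. a (k + m))" for m
  have B: "0 < B"
    using assms(7) C by (simp add: B_def)
  have bound: "stummel_modulus p\<^sub>2 \<Psi>\<^sub>2 f (1 / 2 ^ m) \<le> ennreal (T m powr (1 / p\<^sub>2))" for m
    unfolding stummel_modulus_def
  proof (intro SUP_least ennreal_powr_le)
    fix x
    \<comment> \<open>Starting from a dyadic radius makes the k-th radius
      \<open>1 / 2 ^ (k + m)\<close>, so every \<open>m\<close> and every centre lead to a tail of
      the same series.\<close>
    define \<rho> :: "nat \<Rightarrow> real" where "\<rho> k = 1 / 2 ^ m / 2 ^ k" for k
    have \<rho>: "0 < \<rho> k" "\<rho> (Suc k) = \<rho> k / 2" "\<rho> k = 1 / 2 ^ (k + m)" for k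
      by (auto simp: \<rho>_def power_add)
    have "(\<integral>\<^sup>+ y \<in> ball x (1 / 2 ^ m).
        ennreal (norm (f y) powr p\<^sub>2 * \<Psi>\<^sub>2 (norm (x - y)) / norm (x - y) ^ CARD('n)) \<partial>lebesgue)
      \<le> (\<Sum>k. ennreal (A\<^sub>3 * \<Psi>\<^sub>2 (\<rho> (Suc k)) / \<rho> (Suc k) ^ CARD('n)) *
        (\<integral>\<^sup>+ y \<in> ball x (\<rho> k). ennreal (norm (f y) powr p\<^sub>2) \<partial>lebesgue))"
      unfolding \<rho>_def using f
      by (intro stummel_integral_le_suminf \<Psi> assms(7) d2) (auto simp: weak_morrey_def)
    also have "\<dots> \<le> (\<Sum>k. ennreal (B * a (k + m)))"
    proof (intro suminf_le)
      fix k
      have "0 \<le> A\<^sub>3 * \<Psi>\<^sub>2 (\<rho> (Suc k)) / \<rho> (Suc k) ^ CARD('n)"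
        using assms(7) \<Psi>(2)[OF \<rho>(1)[of "Suc k"]] \<rho>(1)[of "Suc k"] by simp
      moreover have "A\<^sub>3 * \<Psi>\<^sub>2 (\<rho> (Suc k)) / \<rho> (Suc k) ^ CARD('n) *
          (C * (\<Psi>\<^sub>1 (\<rho> k) powr p\<^sub>2 * \<rho> k ^ CARD('n))) = B * a (k + m)"
      proof -
        have "a (k + m) = \<Psi>\<^sub>1 (\<rho> k) powr p\<^sub>2 * \<Psi>\<^sub>2 (\<rho> (Suc k))"
          by (simp add: a_def \<rho>(3))
        moreover have "\<rho> k ^ CARD('n) = 2 ^ CARD('n) * \<rho> (Suc k) ^ CARD('n)"
          by (simp add: \<rho>(2) power_divide)
        moreover have "\<rho> (Suc k) ^ CARD('n) \<noteq> 0"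
          using \<rho>(1)[of "Suc k"] by simp
        ultimately show ?thesis
          by (simp add: B_def)
      qed
      ultimately have "ennreal (A\<^sub>3 * \<Psi>\<^sub>2 (\<rho> (Suc k)) / \<rho> (Suc k) ^ CARD('n)) *
          ennreal (C * (\<Psi>\<^sub>1 (\<rho> k) powr p\<^sub>2 * \<rho> k ^ CARD('n))) = ennreal (B * a (k + m))"
        by (simp only: flip: ennreal_mult')
      then show "ennreal (A\<^sub>3 * \<Psi>\<^sub>2 (\<rho> (Suc k)) / \<rho> (Suc k) ^ CARD('n)) *
          (\<integral>\<^sup>+ y \<in> ball x (\<rho> k). ennreal (norm (f y) powr p\<^sub>2) \<partial>lebesgue)
          \<le> ennreal (B * a (k + m))"
        using mult_left_mono[OF C(2)[OF \<rho>(1)[of k], of x],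
            of "ennreal (A\<^sub>3 * \<Psi>\<^sub>2 (\<rho> (Suc k)) / \<rho> (Suc k) ^ CARD('n))"]
        by (simp only: zero_le)
    qed auto
    also have "\<dots> = ennreal (T m)"
      unfolding T_def using B a \<open>summable a\<close>
      by (intro suminf_ennreal_eq sums_mult summable_sums summable_ignore_initial_segment) auto
    finally show "(\<integral>\<^sup>+ y \<in> ball x (1 / 2 ^ m).
        ennreal (norm (f y) powr p\<^sub>2 * \<Psi>\<^sub>2 (norm (x - y)) / norm (x - y) ^ CARD('n)) \<partial>lebesgue)
      \<le> ennreal (T m)" .
  qed (use p in auto)
  have "T \<longlonglongrightarrow> B * 0"
    unfolding T_def by (intro tendsto_mult tendsto_const suminf_exist_split2 \<open>summable a\<close>)
  \<comment> \<open>The limit of \<open>T\<close> is 0, where \<open>tendsto_powr'\<close> asks for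
    nonnegative bases and a positive exponent.\<close>
  moreover have "0 \<le> T m" for m
    unfolding T_def using B a \<open>summable a\<close>
    by (intro mult_nonneg_nonneg suminf_nonneg summable_ignore_initial_segment) auto
  ultimately have "(\<lambda>m. T m powr (1 / p\<^sub>2)) \<longlonglongrightarrow> 0 powr (1 / p\<^sub>2)"
    using p by (intro tendsto_powr') auto
  then have T0: "(\<lambda>m. ennreal (T m powr (1 / p\<^sub>2))) \<longlonglongrightarrow> 0"
    using tendsto_ennrealI by fastforce
  have "(stummel_modulus p\<^sub>2 \<Psi>\<^sub>2 f \<longlongrightarrow> 0) (at_right 0)"
  \<comment> \<open>Only the upper estimate has content, as nothing in \<open>ennreal\<close> lies
    below 0. One dyadic radius with a small modulus is enough, by monotonicity.\<close>
  proof (rule order_tendstoI)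
    fix e :: ennreal
    assume "0 < e"
    then obtain m where "ennreal (T m powr (1 / p\<^sub>2)) < e"
      using order_tendstoD(2)[OF T0] by (auto simp: eventually_sequentially)
    then have m: "stummel_modulus p\<^sub>2 \<Psi>\<^sub>2 f (1 / 2 ^ m) < e"
      using bound[of m] by (rule le_less_trans[rotated])
    have "\<forall>\<^sub>F r::real in at_right 0. r < 1 / 2 ^ m"
      unfolding eventually_at_right_field by (intro exI[of _ "1 / 2 ^ m"]) auto
    then show "\<forall>\<^sub>F r in at_right 0. stummel_modulus p\<^sub>2 \<Psi>\<^sub>2 f r < e"
      by eventually_elim (use stummel_modulus_mono m p in \<open>meson le_less_trans less_imp_le\<close>)
  qed simp
  moreover have "f \<in> Lp_loc p\<^sub>2"
    using weak_morrey_subset_Lp_loc[where \<Psi> = \<Psi>\<^sub>1, OF p assms(2) \<Psi>(1)] f by blast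
  ultimately show "f \<in> stummel_class p\<^sub>2 \<Psi>\<^sub>2"
    by (simp add: stummel_class_def)
qed

end
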